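(* Let $D=d_1\times d_2\times\cdots$ (explainable dimensions), $C=c_1\times c_2\times\cdots$ and $C'$ (channel dimensions) be finite tensor shapes, let $f:\mathbb{R}^{D\times C}\to\mathbb{R}^{C'}$ be an arbitrary function, and let $r\in\mathbb{R}^{D\times C}$ be a fixed reference tensor. Let $g(x;f)=\Omega(x,f)\in\mathbb{R}^{D\times C'}$ be the Shallow ShapNet explanation and let $\mathcal{G}_f:\mathbb{R}^{D\times C}\to\mathbb{R}^{C'}$ be the Shallow ShapNet, $[\mathcal{G}_f(x)]_j=\sum_{i\in\mathcal{I}_D}[g(x;f)]_{i,j}$. Then Shallow ShapNets compute the exact Shapley values: $g(x;f)=\phi(\mathcal{G}_f,x)$ for every $x\in\mathbb{R}^{D\times C}$, i.e. $$[g(x;f)]_{i,j}=\phi_i\big((\mathcal{G}_f)_j,x\big)\qquad\text{for all } i\in\mathcal{I}_D,\ j\in\mathcal{I}_{C'},$$ where $(\mathcal{G}_f)_j$ denotes the $j$-th scalar output of $\mathcal{G}_f$.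
   Context: $\mathcal{I}_D$ and $\mathcal{I}_{C'}$ denote the finite sets of all indices of the dimensions $D$ and $C'$; put $d=|\mathcal{I}_D|\ge 1$. A tensor $x\in\mathbb{R}^{D\times C}$ has, for each $i\in\mathcal{I}_D$, a component $x_i\in\mathbb{R}^{C}$ (all channels of a given explainable index are treated as one group). SHAP values (with a baseline/reference): fix a reference tensor $r\in\mathbb{R}^{D\times C}$. For $z\in\{0,1\}^{\mathcal{I}_D}$ let $\Psi_{x,r}(z)\in\mathbb{R}^{D\times C}$ be the tensor whose $i$-th component is $x_i$ if $z_i=1$ and $r_i$ if $z_i=0$. For a scalar function $f:\mathbb{R}^{D\times C}\to\mathbb{R}$ and $i\in\mathcal{I}_D$, $$\phi_i(f,x)=\frac1d\sum_{z\in\{0,1\}^{\mathcal{I}_D},\,z_i=0}\binom{d-1}{\|z\|_1}^{-1}\Big[f\big(\Psi_{x,r}(z\cup\{i\})\big)-f\big(\Psi_{x,r}(z)\big)\Big],$$ where $\|z\|_1=\sum_i z_i$ and $z\cup\{i\}$ is $z$ with its $i$-th entry changed from $0$ to $1$. Shapley transform: for $f:\mathbb{R}^{D\times C}\to\mathbb{R}^{C'}$ with scalar outputs $f_j$, $j\in\mathcal{I}_{C'}$, $\Omega(x,f)\in\mathbb{R}^{D\times C'}$ is defined by $[\Omega(x,f)]_{i,j}=\phi_i(f_j,x)$. The same reference $r$ is used throughout, including in the Shapley values of $\mathcal{G}_f$. *)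

theory Defs
  imports "HOL-Analysis.Finite_Cartesian_Product"
begin

text \<open>
  The index sets of the explainable dimensions and of the input and output channels are the
  finite types \<open>'d\<close>, \<open>'c\<close>, \<open>'k\<close>. A multi-dimensional shape is an instance with a product type,
  e.g. \<open>'d = 'd1 \<times> 'd2\<close>. A tensor is \<open>x :: real ^ 'c ^ 'd\<close>, so that \<open>x $ i :: real ^ 'c\<close> is
  the group of all channels at the explainable index \<open>i\<close>. A binary mask \<open>z\<close> is a function
  \<open>'d \<Rightarrow> bool\<close>, where \<open>True\<close> stands for 1, so \<open>z(i := True)\<close> is the mask \<open>z \<union> {i}\<close>.
\<close>

definition mask_size :: "('d::finite \<Rightarrow> bool) \<Rightarrow> nat" where
  "mask_size z = (\<Sum>i\<in>UNIV. of_bool (z i))"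

definition masked_input ::
  "real ^ 'c ^ 'd \<Rightarrow> real ^ 'c ^ 'd \<Rightarrow> ('d::finite \<Rightarrow> bool) \<Rightarrow> real ^ 'c ^ 'd" where
  "masked_input r x z = (\<chi> i. if z i then x $ i else r $ i)"

definition shapley_value ::
  "real ^ 'c ^ 'd \<Rightarrow> (real ^ 'c ^ 'd \<Rightarrow> real) \<Rightarrow> real ^ 'c ^ 'd \<Rightarrow> 'd::finite \<Rightarrow> real" where
  "shapley_value r f x i =
     1 / real CARD('d) *
     (\<Sum>z | \<not> z i.
        inverse (real ((CARD('d) - 1) choose mask_size z)) *
        (f (masked_input r x (z(i := True))) - f (masked_input r x z)))"

definition shapley_transform ::
  "real ^ 'c ^ 'd \<Rightarrow> real ^ 'c ^ 'd \<Rightarrow> (real ^ 'c ^ 'd \<Rightarrow> real ^ 'k) \<Rightarrow> real ^ 'k ^ 'd::finite" where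
  "shapley_transform r x f = (\<chi> i j. shapley_value r (\<lambda>y. f y $ j) x i)"

definition shapnet_explanation ::
  "real ^ 'c ^ 'd \<Rightarrow> (real ^ 'c ^ 'd \<Rightarrow> real ^ 'k) \<Rightarrow> real ^ 'c ^ 'd \<Rightarrow> real ^ 'k ^ 'd::finite" where
  "shapnet_explanation r f x = shapley_transform r x f"

definition shallow_shapnet ::
  "real ^ 'c ^ 'd::finite \<Rightarrow> (real ^ 'c ^ 'd \<Rightarrow> real ^ 'k) \<Rightarrow> real ^ 'c ^ 'd \<Rightarrow> real ^ 'k" where
  "shallow_shapnet r f x = (\<chi> j. \<Sum>i\<in>UNIV. shapnet_explanation r f x $ i $ j)"

end

theory Submission imports Defs begin

text \<open>
  Shapley values are efficient: they sum up to \<open>f x - f r\<close>, because in the total every mask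
  other than the full and the empty one receives the weights \<open>1 / (d choose \<parallel>z\<parallel>)\<close> and
  \<open>- 1 / (d choose \<parallel>z\<parallel>)\<close>. Hence the Shallow ShapNet is \<open>f\<close> minus the constant \<open>f r\<close>, and the
  constant cancels in the differences that define its Shapley values.
\<close>

lemma mask_size_eq_card: "mask_size z = card {i. z i}"
  by (simp add: mask_size_def)

lemma mask_size_le: "mask_size (z :: 'd::finite \<Rightarrow> bool) \<le> CARD('d)"
  unfolding mask_size_eq_card by (simp add: card_mono)

lemma mask_size_eq_0_iff: "mask_size z = 0 \<longleftrightarrow> z = (\<lambda>_. False)"
  by (auto simp: mask_size_eq_card)

lemma mask_size_eq_CARD_iff:
  fixes z :: "'d::finite \<Rightarrow> bool"
  shows "mask_size z = CARD('d) \<longleftrightarrow> z = (\<lambda>_. True)"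
proof
  assume "mask_size z = CARD('d)"
  then have "{i. z i} = UNIV"
    by (intro card_subset_eq) (auto simp: mask_size_eq_card)
  then show "z = (\<lambda>_. True)"
    by auto
qed (simp add: mask_size_eq_card)

lemma mask_size_fun_upd_False:
  assumes "z i"
  shows "mask_size (z(i := False)) = mask_size z - 1"
proof -
  have "{j. (z(i := False)) j} = {j. z j} - {i}"
    by auto
  then show ?thesis
    using assms by (simp add: mask_size_eq_card del: fun_upd_apply)
qed

text \<open>Switching bit \<open>i\<close> on is a bijection from the masks without \<open>i\<close>
  onto those with \<open>i\<close>; switching it off is the inverse.\<close>

lemma sum_masks_fun_upd_True:
  fixes h :: "('d::finite \<Rightarrow> bool) \<Rightarrow> ('d \<Rightarrow> bool) \<Rightarrow> real"
  shows "(\<Sum>z | \<not> z i. h z (z(i := True))) = (\<Sum>z | z i. h (z(i := False)) z)"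
  by (rule sum.reindex_bij_witness[where i = "\<lambda>z. z(i := False)" and j = "\<lambda>z. z(i := True)"])
    (auto simp: fun_upd_idem)

text \<open>Double counting. It serves twice: for the indices inside a mask and for those outside
  it.\<close>

lemma sum_swap_index_mask:
  fixes g :: "('d::finite \<Rightarrow> bool) \<Rightarrow> real"
    and P :: "('d \<Rightarrow> bool) \<Rightarrow> 'd \<Rightarrow> bool"
  shows "(\<Sum>i\<in>UNIV. \<Sum>z | P z i. g z) = (\<Sum>z\<in>UNIV. real (card {i. P z i}) * g z)"
proof -
  have "(\<Sum>i\<in>UNIV. \<Sum>z | P z i. g z) = (\<Sum>z\<in>UNIV. \<Sum>i | P z i. g z)"
    using sum.swap_restrict[of "UNIV :: 'd set" "UNIV :: ('d \<Rightarrow> bool) set" "\<lambda>i z. g z" "\<lambda>i z. P z i"]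
    by simp
  then show ?thesis
    by simp
qed

text \<open>Absorption: \<open>k * (n choose k) = n * ((n - 1) choose (k - 1))\<close>. A mask of
  size \<open>k\<close> is the upper end of \<open>k\<close> marginal contributions; at
  \<open>k = 0\<close> the factor \<open>real k\<close> makes the truncated \<open>k - 1\<close>
  harmless.\<close>

lemma shapley_weight_upper:
  assumes "k \<le> n"
  shows "real k * (1 / real n * inverse (real ((n - 1) choose (k - 1)))) =
    (if k = 0 then 0 else 1 / real (n choose k))"
proof (cases k)
  case (Suc m)
  have "real k * real (n choose k) = real n * real ((n - 1) choose m)"
    using binomial_absorption[of m n] Suc by (metis of_nat_mult)
  moreover have "real (n choose k) \<noteq> 0" "real ((n - 1) choose m) \<noteq> 0" "real n \<noteq> 0"
    using assms Suc by auto
  ultimately show ?thesis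
    using Suc by (simp add: field_simps)
qed simp

text \<open>Complementary absorption:
  \<open>(n - k) * (n choose k) = n * ((n - 1) choose k)\<close>. A mask of size \<open>k\<close> is
  the lower end of \<open>n - k\<close> marginal contributions.\<close>

lemma shapley_weight_lower:
  assumes "k \<le> n"
  shows "real (n - k) * (1 / real n * inverse (real ((n - 1) choose k))) =
    (if k = n then 0 else 1 / real (n choose k))"
proof (cases "k = n")
  case False
  have "real (n - k) * real (n choose k) = real n * real ((n - 1) choose k)"
    using binomial_absorb_comp[of n k] by (metis of_nat_mult)
  moreover have "real (n choose k) \<noteq> 0" "real ((n - 1) choose k) \<noteq> 0" "real n \<noteq> 0"
    using assms False by auto
  ultimately show ?thesis
    using False by (simp add: divide_simps mult_ac)
qed simp

lemma shapley_value_efficiency: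
  fixes r x :: "real ^ 'c ^ 'd::finite"
  shows "(\<Sum>i\<in>UNIV. shapley_value r f x i) = f x - f r"
proof -
  define n where "n = CARD('d)"
  define w where "w k = 1 / real n * inverse (real ((n - 1) choose k))" for k
  define v where "v z = f (masked_input r x z)" for z
  \<comment> \<open>Indexing the first sum by the upper mask collects all terms at
    \<open>v z\<close>; the weight then uses the size of the predecessor,
    \<open>mask_size z - 1\<close>.\<close>
  have sv: "shapley_value r f x i =
      (\<Sum>z | z i. w (mask_size z - 1) * v z) - (\<Sum>z | \<not> z i. w (mask_size z) * v z)" for i
  proof -
    have "shapley_value r f x i =
        (\<Sum>z | \<not> z i. w (mask_size z) * v (z(i := True))) - (\<Sum>z | \<not> z i. w (mask_size z) * v z)"
      by (simp add: shapley_value_def w_def v_def n_def sum_distrib_left sum_subtractf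
          right_diff_distrib mult.assoc)
    also have "(\<Sum>z | \<not> z i. w (mask_size z) * v (z(i := True))) =
        (\<Sum>z | z i. w (mask_size z - 1) * v z)"
      using sum_masks_fun_upd_True[of "\<lambda>z z'. w (mask_size z) * v z'" i]
      by (simp add: mask_size_fun_upd_False)
    finally show ?thesis .
  qed
  have card_not: "card {i. \<not> z i} = n - mask_size z" for z :: "'d \<Rightarrow> bool"
    by (simp add: mask_size_eq_card n_def Collect_neg_eq Compl_eq_Diff_UNIV card_Diff_subset)
  have n_pos: "n > 0"
    by (simp add: n_def)
  \<comment> \<open>For sizes strictly between 0 and \<open>n\<close> the two weights cancel. The
    full mask keeps only the first, the empty mask only the second, and there the binomial is 1;
    \<open>n_pos\<close> keeps these cases apart.\<close>
  have coeff: "real (mask_size z) * w (mask_size z - 1) - real (n - mask_size z) * w (mask_size z) =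
      of_bool (z = (\<lambda>_. True)) - of_bool (z = (\<lambda>_. False))" for z :: "'d \<Rightarrow> bool"
    using shapley_weight_upper[of "mask_size z" n] shapley_weight_lower[of "mask_size z" n]
      mask_size_le[of z] mask_size_eq_0_iff[of z] mask_size_eq_CARD_iff[of z] n_pos
    unfolding w_def n_def[symmetric] by (auto split: if_splits)
  have "(\<Sum>i\<in>UNIV. shapley_value r f x i) =
      (\<Sum>z\<in>UNIV. (real (mask_size z) * w (mask_size z - 1)
        - real (n - mask_size z) * w (mask_size z)) * v z)"
    unfolding sv sum_subtractf sum_swap_index_mask card_not
    by (simp add: mask_size_eq_card left_diff_distrib sum_subtractf mult.assoc)
  also have "\<dots> = (\<Sum>z\<in>UNIV. of_bool (z = (\<lambda>_. True)) * v z)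
      - (\<Sum>z\<in>UNIV. of_bool (z = (\<lambda>_. False)) * v z)"
    unfolding coeff by (simp add: left_diff_distrib sum_subtractf)
  also have "\<dots> = v (\<lambda>_. True) - v (\<lambda>_. False)"
    by (simp add: of_bool_def if_distrib[of "\<lambda>a. a * _"] cong: if_cong)
  also have "\<dots> = f x - f r"
    by (simp add: v_def masked_input_def)
  finally show ?thesis .
qed

text \<open>Efficiency in each output channel. Since \<open>x\<close> is arbitrary, the rewriting
  also applies at the masked inputs inside a Shapley value.\<close>

lemma shallow_shapnet_nth: "shallow_shapnet r f x $ j = f x $ j - f r $ j"
  by (simp add: shallow_shapnet_def shapnet_explanation_def shapley_transform_def
      shapley_value_efficiency)

theorem theorem2:
  fixes f :: "real ^ 'c ^ 'd \<Rightarrow> real ^ 'k"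
    and r :: "real ^ 'c ^ 'd::finite"
  shows "\<forall>x i j. shapnet_explanation r f x $ i $ j =
                 shapley_value r (\<lambda>y. shallow_shapnet r f y $ j) x i"
  by (simp add: shallow_shapnet_nth shapnet_explanation_def shapley_transform_def
      shapley_value_def)

end
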